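(* Consider the discrete-time dynamical system $\Sigma=(X,D,f)$ with state space $X\subset\mathbb{R}^n$ and dynamics $x(k+1)=f(x(k))+d(k)$, $d(k)\in D$, $k\in\mathbb{N}$, an LTL$_F$ specification $\psi$ and a point $x\in X$. Let $g_\psi$ denote the resilience of $\Sigma$ with respect to $\psi$. The following properties hold: (i) when $\psi$ is the $\mathsf{true}$ specification, $g_\psi(x)=+\infty$ for all $x\in X$; (ii) when $\psi$ is the $\mathsf{false}$ specification, $g_\psi(x)=0$ for all $x\in X$; (iii) for any specification $\psi=\psi_1\wedge\psi_2$, $g_\psi(x)=\min\{g_{\psi_1}(x),g_{\psi_2}(x)\}$ for all $x\in X$; (iv) for any specification $\psi=\psi_1\vee\psi_2$, $g_\psi(x)\ge\max\{g_{\psi_1}(x),g_{\psi_2}(x)\}$ for all $x\in X$; (v) for any specification $\psi=\neg\phi$, $g_\psi(x)\,g_\phi(x)=0$ for all $x\in X$ (with $0\cdot(+\infty)=0$); (vi) for $A\subset X$, $g_\psi(A)=\inf_{x\in A}g_\psi(x)$.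
   Context: Let $\mathsf{AP}$ be a finite set of atomic propositions and $\mathsf{L}:X\to 2^{\mathsf{AP}}$ a measurable labeling function. LTL$_F$ formulas over $\mathsf{AP}$ are built inductively as $\psi::=\mathsf{true}\mid p\mid\neg\psi\mid\psi_1\wedge\psi_2\mid\psi_1\vee\psi_2\mid\bigcirc\psi\mid\psi_1\,\mathsf{U}\,\psi_2\mid\square\psi\mid\lozenge\psi$ with $p\in\mathsf{AP}$. For a finite word $\omega=(\omega_0,\dots,\omega_{N-1})$ with letters in $2^{\mathsf{AP}}$, satisfaction at step $i<N$ is defined by: $\omega_i\vDash\mathsf{true}$ always holds and $\omega_i\vDash\mathsf{false}$ never holds; $\omega_i\vDash p$ if $p\in\omega_i$; $\omega_i\vDash\neg\psi$ if $\omega_i\nvDash\psi$; $\wedge$ and $\vee$ are interpreted as "and" and "or"; $\omega_i\vDash\bigcirc\psi$ if $\omega_{i+1}\vDash\psi$; $\omega_i\vDash\psi_1\,\mathsf{U}\,\psi_2$ if for some $m$ with $i\le m<N$ we have $\omega_m\vDash\psi_2$ and $\omega_k\vDash\psi_1$ for all $i\le k<m$; $\omega_i\vDash\square\psi$ if $\omega_m\vDash\psi$ for all $i\le m<N$; $\omega_i\vDash\lozenge\psi$ if $\omega_m\vDash\psi$ for some $i\le m<N$. One writes $\omega\vDash\psi$ iff $\omega_0\vDash\psi$. A trajectory $w=(x_0,\dots,x_{N-1})\in X^N$ of length $N$ satisfies $\psi$ iff the word $(\mathsf{L}(x_0),\dots,\mathsf{L}(x_{N-1}))$ does; a set of trajectories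 satisfies $\psi$ iff all of its elements do. For $\varepsilon\ge 0$ the disturbance set is $D=\Omega_\varepsilon(0)=\{z\in\mathbb{R}^n:\|z\|_\infty\le\varepsilon\}$, and $\xi(x,\varepsilon)$ denotes the set of trajectories $(x_0,x_1,x_2,\dots)$ of the system with $x_0=x$ and $x_{k+1}\in f(x_k)+\Omega_\varepsilon(0)$; in particular $\xi(x,0)$ contains only the disturbance-free (nominal) trajectory from $x$. For $A\subseteq X$, $\xi(A,\varepsilon)=\bigcup_{x\in A}\xi(x,\varepsilon)$. The resilience with respect to $\psi$ is the function $g_\psi:X\to\mathbb{R}_{\ge 0}\cup\{+\infty\}$ with $g_\psi(x)=\sup\{\varepsilon\ge 0\mid\xi(x,\varepsilon)\vDash\psi\}$ if $\xi(x,0)\vDash\psi$, and $g_\psi(x)=0$ if $\xi(x,0)\nvDash\psi$. For a set $A\subseteq X$, $g_\psi(A)=\sup\{\varepsilon\ge 0\mid\xi(A,\varepsilon)\vDash\psi\}$ if $\xi(A,0)\vDash\psi$, and $g_\psi(A)=0$ if $\xi(A,0)\nvDash\psi$. *)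

theory Defs
  imports "HOL-Analysis.Analysis"
begin

datatype (ltlf_atoms: 'p) ltlf =
    TrueF
  | Prop 'p
  | Neg "'p ltlf"
  | Conj "'p ltlf" "'p ltlf"
  | Disj "'p ltlf" "'p ltlf"
  | Next "'p ltlf"
  | Until "'p ltlf" "'p ltlf"
  | Always "'p ltlf"
  | Eventually "'p ltlf"

abbreviation FalseF :: "'p ltlf" where
  "FalseF \<equiv> Neg TrueF"

text \<open>
  Satisfaction is only meaningful at steps \<open>i < length \<omega>\<close>. The next operator is the strong
  one: at the last step of the word there is no successor, and \<open>Next \<psi>\<close> is violated.
\<close>

primrec ltlf_sat :: "'p set list \<Rightarrow> nat \<Rightarrow> 'p ltlf \<Rightarrow> bool" where
  "ltlf_sat \<omega> i TrueF \<longleftrightarrow> True"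
| "ltlf_sat \<omega> i (Prop p) \<longleftrightarrow> p \<in> \<omega> ! i"
| "ltlf_sat \<omega> i (Neg \<psi>) \<longleftrightarrow> \<not> ltlf_sat \<omega> i \<psi>"
| "ltlf_sat \<omega> i (Conj \<psi>1 \<psi>2) \<longleftrightarrow> ltlf_sat \<omega> i \<psi>1 \<and> ltlf_sat \<omega> i \<psi>2"
| "ltlf_sat \<omega> i (Disj \<psi>1 \<psi>2) \<longleftrightarrow> ltlf_sat \<omega> i \<psi>1 \<or> ltlf_sat \<omega> i \<psi>2"
| "ltlf_sat \<omega> i (Next \<psi>) \<longleftrightarrow> Suc i < length \<omega> \<and> ltlf_sat \<omega> (Suc i) \<psi>"
| "ltlf_sat \<omega> i (Until \<psi>1 \<psi>2) \<longleftrightarrow>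
     (\<exists>m. i \<le> m \<and> m < length \<omega> \<and> ltlf_sat \<omega> m \<psi>2 \<and> (\<forall>k. i \<le> k \<and> k < m \<longrightarrow> ltlf_sat \<omega> k \<psi>1))"
| "ltlf_sat \<omega> i (Always \<psi>) \<longleftrightarrow> (\<forall>m. i \<le> m \<and> m < length \<omega> \<longrightarrow> ltlf_sat \<omega> m \<psi>)"
| "ltlf_sat \<omega> i (Eventually \<psi>) \<longleftrightarrow> (\<exists>m. i \<le> m \<and> m < length \<omega> \<and> ltlf_sat \<omega> m \<psi>)"

lemma ltlf_sat_FalseF: "\<not> ltlf_sat \<omega> i FalseF"
  by simp

definition word_sat :: "'p set list \<Rightarrow> 'p ltlf \<Rightarrow> bool" where
  "word_sat \<omega> \<psi> \<longleftrightarrow> ltlf_sat \<omega> 0 \<psi>"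

definition inf_ball :: "real ^ 'n \<Rightarrow> real \<Rightarrow> (real ^ 'n) set" where
  "inf_ball c \<epsilon> = {z. infnorm (z - c) \<le> \<epsilon>}"

text \<open>
  Trajectories live in the state space \<open>X\<close>: a disturbance that would drive the state out of \<open>X\<close>
  contributes no trajectory. If \<open>f\<close> maps \<open>X\<close> into itself, the nominal trajectory exists from
  every point of \<open>X\<close> (lemma \<open>xi_zero\<close> below).
\<close>

definition trajectories ::
    "(real ^ 'n) set \<Rightarrow> (real ^ 'n) set \<Rightarrow> (real ^ 'n \<Rightarrow> real ^ 'n) \<Rightarrow> real ^ 'n
       \<Rightarrow> (nat \<Rightarrow> real ^ 'n) set" where
  "trajectories X D f x =
     {w. w 0 = x \<and> (\<forall>k. w k \<in> X) \<and> (\<forall>k. \<exists>d\<in>D. w (Suc k) = f (w k) + d)}"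

definition xi ::
    "(real ^ 'n) set \<Rightarrow> (real ^ 'n \<Rightarrow> real ^ 'n) \<Rightarrow> real ^ 'n \<Rightarrow> real
       \<Rightarrow> (nat \<Rightarrow> real ^ 'n) set" where
  "xi X f x \<epsilon> = trajectories X (inf_ball 0 \<epsilon>) f x"

definition xi_set ::
    "(real ^ 'n) set \<Rightarrow> (real ^ 'n \<Rightarrow> real ^ 'n) \<Rightarrow> (real ^ 'n) set \<Rightarrow> real
       \<Rightarrow> (nat \<Rightarrow> real ^ 'n) set" where
  "xi_set X f A \<epsilon> = (\<Union>x\<in>A. xi X f x \<epsilon>)"

lemma xi_zero:
  fixes f :: "real ^ 'n \<Rightarrow> real ^ 'n"
  assumes "f \<in> X \<rightarrow> X" and "x \<in> X"
  shows "xi X f x 0 = {\<lambda>k. (f ^^ k) x}"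
proof -
  have inX: "(f ^^ k) x \<in> X" for k
    using assms by (induction k) auto
  have b: "inf_ball (0 :: real ^ 'n) 0 = {0}"
    by (auto simp: inf_ball_def infnorm_0
             dest: infnorm_eq_0[THEN iffD1, OF order_antisym[OF _ infnorm_pos_le]])
  have "w k = (f ^^ k) x" if "w 0 = x" "\<forall>k. w (Suc k) = f (w k)" for w :: "nat \<Rightarrow> real ^ 'n" and k
    using that by (induction k) auto
  with inX show ?thesis
    by (auto simp: xi_def trajectories_def b)
qed

text \<open>
  The specification is interpreted over a fixed horizon \<open>N\<close>: a trajectory satisfies it iff the
  word of labels of its first \<open>N\<close> states does.
\<close>

definition traj_sat :: "('s \<Rightarrow> 'p set) \<Rightarrow> nat \<Rightarrow> (nat \<Rightarrow> 's) \<Rightarrow> 'p ltlf \<Rightarrow> bool" where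
  "traj_sat L N w \<psi> \<longleftrightarrow> word_sat (map (\<lambda>k. L (w k)) [0..<N]) \<psi>"

definition trajs_sat :: "('s \<Rightarrow> 'p set) \<Rightarrow> nat \<Rightarrow> (nat \<Rightarrow> 's) set \<Rightarrow> 'p ltlf \<Rightarrow> bool" where
  "trajs_sat L N W \<psi> \<longleftrightarrow> (\<forall>w\<in>W. traj_sat L N w \<psi>)"

definition resilience ::
    "(real ^ 'n) set \<Rightarrow> (real ^ 'n \<Rightarrow> real ^ 'n) \<Rightarrow> (real ^ 'n \<Rightarrow> 'p set) \<Rightarrow> nat
       \<Rightarrow> 'p ltlf \<Rightarrow> real ^ 'n \<Rightarrow> ennreal" where
  "resilience X f L N \<psi> x =
     (if trajs_sat L N (xi X f x 0) \<psi>
      then (SUP \<epsilon>\<in>{\<epsilon>. 0 \<le> \<epsilon> \<and> trajs_sat L N (xi X f x \<epsilon>) \<psi>}. ennreal \<epsilon>)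
      else 0)"

definition resilience_set ::
    "(real ^ 'n) set \<Rightarrow> (real ^ 'n \<Rightarrow> real ^ 'n) \<Rightarrow> (real ^ 'n \<Rightarrow> 'p set) \<Rightarrow> nat
       \<Rightarrow> 'p ltlf \<Rightarrow> (real ^ 'n) set \<Rightarrow> ennreal" where
  "resilience_set X f L N \<psi> A =
     (if trajs_sat L N (xi_set X f A 0) \<psi>
      then (SUP \<epsilon>\<in>{\<epsilon>. 0 \<le> \<epsilon> \<and> trajs_sat L N (xi_set X f A \<epsilon>) \<psi>}. ennreal \<epsilon>)
      else 0)"

end

theory Submission
  imports Defs
begin

text \<open>
  Enlarging \<open>\<epsilon>\<close> enlarges the set of trajectories, so satisfaction is antitone in \<open>\<epsilon>\<close>. Hence the
  case distinction at \<open>\<epsilon> = 0\<close> is absorbed by the supremum of the empty set being \<open>0\<close>, and the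
  resilience is the length of an initial segment of \<open>[0, \<infinity>)\<close>. The length of an intersection of
  initial segments is the infimum of the lengths; this gives (i), (iii) and (vi).
\<close>

definition margin :: "(real \<Rightarrow> bool) \<Rightarrow> ennreal" where
  "margin P = (SUP \<epsilon>\<in>{\<epsilon>. 0 \<le> \<epsilon> \<and> P \<epsilon>}. ennreal \<epsilon>)"

lemma margin_mono:
  assumes "\<And>\<epsilon>. P \<epsilon> \<Longrightarrow> Q \<epsilon>"
  shows "margin P \<le> margin Q"
  unfolding margin_def using assms by (intro SUP_subset_mono) auto

lemma margin_eq_0_if_not:
  assumes "antimono P" and "\<not> P 0"
  shows "margin P = 0"
proof -
  have "{\<epsilon>. 0 \<le> \<epsilon> \<and> P \<epsilon>} = {}"
    using assms by (blast dest: antimonoD[THEN le_boolD])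
  then show ?thesis
    unfolding margin_def by (simp only: image_empty Sup_empty bot_ennreal)
qed

text \<open>The strict bound yields a point \<open>\<delta>\<close> of the set beyond
  \<open>\<epsilon>\<close>, and antitonicity carries \<open>P\<close> down from it. At
  \<open>\<epsilon>\<close> equal to the margin \<open>P\<close> may fail, since the supremum need
  not be attained.\<close>

lemma less_marginD:
  assumes "antimono P" and "ennreal \<epsilon> < margin P"
  shows "P \<epsilon>"
proof -
  obtain \<delta> where "0 \<le> \<delta>" "P \<delta>" "ennreal \<epsilon> < ennreal \<delta>"
    using assms(2) unfolding margin_def less_SUP_iff by auto
  \<comment> \<open>Contraposition of the monotonicity of \<open>ennreal\<close>; this covers
    negative \<open>\<epsilon>\<close>, which \<open>ennreal\<close> sends to 0.\<close>
  moreover from this have "\<epsilon> \<le> \<delta>"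
    by (meson ennreal_leI linorder_not_le nle_le)
  ultimately show ?thesis
    using assms(1) by (blast dest: antimonoD[THEN le_boolD])
qed

text \<open>Antitonicity enters only in \<ge>: a level below all margins satisfies every
  \<open>P i\<close> at once. For empty \<open>I\<close> both sides are infinite.\<close>

lemma margin_Ball:
  assumes "\<And>i. i \<in> I \<Longrightarrow> antimono (P i)"
  shows "margin (\<lambda>\<epsilon>. \<forall>i\<in>I. P i \<epsilon>) = (INF i\<in>I. margin (P i))"
proof (rule antisym)
  show "margin (\<lambda>\<epsilon>. \<forall>i\<in>I. P i \<epsilon>) \<le> (INF i\<in>I. margin (P i))"
    by (intro INF_greatest margin_mono) auto
  show "(INF i\<in>I. margin (P i)) \<le> margin (\<lambda>\<epsilon>. \<forall>i\<in>I. P i \<epsilon>)"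
  \<comment> \<open>Working strictly below the infimum avoids the question whether the suprema are
    attained.\<close>
  proof (rule dense_le)
    fix y assume y: "y < (INF i\<in>I. margin (P i))"
    \<comment> \<open>Being strictly below something, \<open>y\<close> is not \<infinity>.\<close>
    then obtain \<epsilon> where \<epsilon>: "0 \<le> \<epsilon>" "y = ennreal \<epsilon>"
      by (cases y) auto
    have "P i \<epsilon>" if "i \<in> I" for i
      using y that assms \<epsilon> by (blast intro: less_marginD less_le_trans INF_lower)
    with \<epsilon> show "y \<le> margin (\<lambda>\<epsilon>. \<forall>i\<in>I. P i \<epsilon>)"
      unfolding margin_def by (auto intro: SUP_upper)
  qed
qed

lemma xi_mono: "\<epsilon> \<le> \<delta> \<Longrightarrow> xi X f x \<epsilon> \<subseteq> xi X f x \<delta>"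
  unfolding xi_def trajectories_def inf_ball_def by fastforce

lemma antimono_trajs_sat_xi: "antimono (\<lambda>\<epsilon>. trajs_sat L N (xi X f x \<epsilon>) \<psi>)"
  by (rule antimonoI) (use xi_mono in \<open>force simp: trajs_sat_def\<close>)

lemma trajs_sat_xi_set:
  "trajs_sat L N (xi_set X f A \<epsilon>) \<psi> \<longleftrightarrow> (\<forall>x\<in>A. trajs_sat L N (xi X f x \<epsilon>) \<psi>)"
  by (auto simp: trajs_sat_def xi_set_def)

lemma resilience_eq_margin:
  "resilience X f L N \<psi> x = margin (\<lambda>\<epsilon>. trajs_sat L N (xi X f x \<epsilon>) \<psi>)"
  using margin_eq_0_if_not[OF antimono_trajs_sat_xi]
  by (auto simp: resilience_def margin_def)

lemma resilience_set_eq_margin: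
  "resilience_set X f L N \<psi> A = margin (\<lambda>\<epsilon>. \<forall>x\<in>A. trajs_sat L N (xi X f x \<epsilon>) \<psi>)"
proof -
  have "antimono (\<lambda>\<epsilon>. \<forall>x\<in>A. trajs_sat L N (xi X f x \<epsilon>) \<psi>)"
    by (intro antimonoI le_boolI) (blast dest: antimonoD[OF antimono_trajs_sat_xi, THEN le_boolD])
  from margin_eq_0_if_not[OF this] show ?thesis
    by (auto simp: resilience_set_def trajs_sat_xi_set margin_def)
qed

lemma resilience_TrueF: "resilience X f L N TrueF x = \<infinity>"
proof -
  \<comment> \<open>The infimum over the empty family is the top element.\<close>
  have "margin (\<lambda>\<epsilon>. \<forall>i\<in>{}. True) = \<infinity>"
    by (subst margin_Ball) auto
  then show ?thesis
    by (simp add: resilience_eq_margin trajs_sat_def traj_sat_def word_sat_def)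
qed

lemma resilience_Conj:
  "resilience X f L N (Conj \<psi>1 \<psi>2) x =
     min (resilience X f L N \<psi>1 x) (resilience X f L N \<psi>2 x)"
proof -
  \<comment> \<open>The two conjuncts themselves serve as the index set.\<close>
  have "resilience X f L N (Conj \<psi>1 \<psi>2) x =
      margin (\<lambda>\<epsilon>. \<forall>\<psi>\<in>{\<psi>1, \<psi>2}. trajs_sat L N (xi X f x \<epsilon>) \<psi>)"
    unfolding resilience_eq_margin
    by (rule arg_cong[where f = margin])
       (auto simp: fun_eq_iff trajs_sat_def traj_sat_def word_sat_def)
  also have "\<dots> = (INF \<psi>\<in>{\<psi>1, \<psi>2}. resilience X f L N \<psi> x)"
    unfolding resilience_eq_margin by (intro margin_Ball antimono_trajs_sat_xi)
  finally show ?thesis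
    by (simp add: inf_min)
qed

text \<open>Only an inequality: at a given \<open>\<epsilon>\<close> some trajectories may satisfy
  just \<open>\<psi>1\<close> and others just \<open>\<psi>2\<close>.\<close>

lemma resilience_Disj:
  "max (resilience X f L N \<psi>1 x) (resilience X f L N \<psi>2 x)
     \<le> resilience X f L N (Disj \<psi>1 \<psi>2) x"
  unfolding resilience_eq_margin
  by (intro max.boundedI margin_mono) (auto simp: trajs_sat_def traj_sat_def word_sat_def)

text \<open>Since \<open>f\<close> maps \<open>X\<close> into itself, there is exactly one nominal
  trajectory. It violates \<open>\<phi>\<close> or its negation, and that formula gets the default
  value 0.\<close>

lemma resilience_Neg:
  assumes "f \<in> X \<rightarrow> X" and "x \<in> X"
  shows "resilience X f L N (Neg \<phi>) x = 0 \<or> resilience X f L N \<phi> x = 0"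
  by (simp add: resilience_def xi_zero[OF assms] trajs_sat_def traj_sat_def word_sat_def)

lemma resilience_set_eq_INF:
  "resilience_set X f L N \<psi> A = (INF x\<in>A. resilience X f L N \<psi> x)"
  unfolding resilience_set_eq_margin resilience_eq_margin
  by (intro margin_Ball antimono_trajs_sat_xi)

theorem proposition3p1:
  fixes X :: "(real ^ 'n) set"
    and f :: "real ^ 'n \<Rightarrow> real ^ 'n"
    and AP :: "'p set"
    and L :: "real ^ 'n \<Rightarrow> 'p set"
    and N :: nat
  assumes "finite AP"
    and "L \<in> measurable (restrict_space borel X) (count_space (Pow AP))"
    and "f \<in> X \<rightarrow> X"
    and "1 \<le> N"
  shows
    "(\<forall>x\<in>X. resilience X f L N TrueF x = \<infinity>) \<and>
     (\<forall>x\<in>X. resilience X f L N FalseF x = 0) \<and>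
     (\<forall>\<psi>1 \<psi>2. ltlf_atoms \<psi>1 \<subseteq> AP \<longrightarrow> ltlf_atoms \<psi>2 \<subseteq> AP \<longrightarrow>
        (\<forall>x\<in>X. resilience X f L N (Conj \<psi>1 \<psi>2) x =
                 min (resilience X f L N \<psi>1 x) (resilience X f L N \<psi>2 x))) \<and>
     (\<forall>\<psi>1 \<psi>2. ltlf_atoms \<psi>1 \<subseteq> AP \<longrightarrow> ltlf_atoms \<psi>2 \<subseteq> AP \<longrightarrow>
        (\<forall>x\<in>X. resilience X f L N (Disj \<psi>1 \<psi>2) x \<ge>
                 max (resilience X f L N \<psi>1 x) (resilience X f L N \<psi>2 x))) \<and>
     (\<forall>\<phi>. ltlf_atoms \<phi> \<subseteq> AP \<longrightarrow>
        (\<forall>x\<in>X. resilience X f L N (Neg \<phi>) x * resilience X f L N \<phi> x = 0)) \<and>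
     (\<forall>\<psi>. ltlf_atoms \<psi> \<subseteq> AP \<longrightarrow>
        (\<forall>A. A \<subseteq> X \<longrightarrow>
           resilience_set X f L N \<psi> A = (INF x\<in>A. resilience X f L N \<psi> x)))"
proof -
  have "resilience X f L N FalseF x = 0" if "x \<in> X" for x
    \<comment> \<open>The resilience of \<open>TrueF\<close> is infinite, so the vanishing factor
      must be that of its negation.\<close>
    using resilience_Neg[OF assms(3) that, of L N TrueF] by (simp add: resilience_TrueF)
  moreover have "resilience X f L N (Neg \<phi>) x * resilience X f L N \<phi> x = 0" if "x \<in> X" for \<phi> x
    \<comment> \<open>The other factor may be infinite; in \<open>ennreal\<close> the product with 0
      is still 0.\<close>
    using resilience_Neg[OF assms(3) that, of L N \<phi>] by auto
  ultimately show ?thesis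
    by (simp only: resilience_TrueF resilience_Conj resilience_Disj resilience_set_eq_INF) simp
qed

end
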